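(* Let $\Gamma=(V,T,\mathbf{s},\mathbf{r})$ be a network. Then the semigroup $R_\Gamma$ is a fundamental inverse subsemigroup of $S_\Gamma$.
   Context: A network $\Gamma=(V,T,\mathbf{s},\mathbf{r})$ consists of a set $V$ of vertices, a set $T$ of relations, and maps $\mathbf{s},\mathbf{r}:T\to\mathcal{P}(V)$ such that for every $t\in T$ the sets $\mathbf{s}(t)$ and $\mathbf{r}(t)$ are disjoint non-empty subsets of $V$; $V$ and $T$ are finite or countably infinite. A vertex $v$ is identified with the singleton $\{v\}$. Put $T^0=\{A\subseteq V: A=\mathbf{s}(t)\text{ or }A=\mathbf{r}(t)\text{ for some }t\in T\}\cup V$, and set $\mathbf{s}(A)=A=\mathbf{r}(A)$ for $A\in T^0$. For each $t\in T$ let $t^{-1}$ be a formal symbol with $\mathbf{s}(t^{-1})=\mathbf{r}(t)$, $\mathbf{r}(t^{-1})=\mathbf{s}(t)$; put $A^{-1}=A$ for $A\in T^0$ and $T^{-1}=\{t^{-1}:t\in T\}$. The symbol sets $T$, $T^0$, $T^{-1}$, $\{0\}$ are pairwise disjoint. $Q_\Gamma$ is the semigroup generated by $X=T\cup T^0\cup T^{-1}\cup\{0\}$ subject to the relations: (NR1) $\mathbf{s}(t)t=t=t\mathbf{r}(t)$ for $t\in T\cup T^0\cup T^{-1}$; (NR2) $t_1t_2=0$ if $\mathbf{r}(t_1)\cap\mathbf{s}(t_2)=\emptyset$, for $t_1,t_2\in T\cup T^0\cup T^{-1}$; (NR3) $t_1^{-1}t_2=0$ if $t_1\neq t_2$,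 for $t_1,t_2\in T$; (NR4) $t^{-1}t=\mathbf{r}(t)$ for $t\in T$; (NR5) $t^{-1}A=0$ if $\mathbf{s}(t)\neq A$, for $t\in T$, $A\in T^0$; (NR6) $0x=0=x0$ for all $x\in X$. $[w]$ denotes the class in $Q_\Gamma$ of a word $w$. A non-zero path is a finite non-empty sequence $\alpha=t_1\cdots t_n$ with $t_i\in T\cup T^0$ and $\mathbf{r}(t_i)\cap\mathbf{s}(t_{i+1})\neq\emptyset$ for $1\le i<n$; $\mathbf{s}(\alpha)=\mathbf{s}(t_1)$, $\mathbf{r}(\alpha)=\mathbf{r}(t_n)$, $\alpha^{-1}=t_n^{-1}\cdots t_1^{-1}$. It is linear if $\mathbf{r}(t_i)=\mathbf{s}(t_{i+1})$ for $1\le i<n$, and reduced if $t_i\neq\mathbf{s}(t_{i+1})$ and $t_{i+1}\neq\mathbf{r}(t_i)$ for $1\le i<n$. $RP(\Gamma)$ is the set of reduced paths (together with $0$) and $RLP(\Gamma)$ the set of non-zero reduced linear paths. $S_\Gamma=\{[\alpha\beta^{-1}]\in Q_\Gamma:\alpha\in RP(\Gamma)\setminus\{0\},\ \beta\in RLP(\Gamma)\setminus T^0,\ \mathbf{r}(\alpha)=\mathbf{r}(\beta)\}\cup\{[0]\}$, a subsemigroup of $Q_\Gamma$, and $R_\Gamma=\{[\alpha\beta^{-1}]\in S_\Gamma:\alpha,\beta\in RLP(\Gamma)\setminus T^0,\ \mathbf{r}(\alpha)=\mathbf{r}(\beta)\}\cup\{[0]\}$. A semigroup is fundamental if the only congruence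 contained in Green's relation $\mathcal{H}=\mathcal{L}\cap\mathcal{R}$ is the identity congruence. *)

theory Defs
  imports Main "HOL-Library.Countable_Set"
begin

section \<open>Semigroups on a carrier set\<close>

definition semigroup_on :: "'a set \<Rightarrow> ('a \<Rightarrow> 'a \<Rightarrow> 'a) \<Rightarrow> bool" where
  "semigroup_on S f \<longleftrightarrow> S \<noteq> {} \<and> (\<forall>a\<in>S. \<forall>b\<in>S. f a b \<in> S) \<and>
     (\<forall>a\<in>S. \<forall>b\<in>S. \<forall>c\<in>S. f (f a b) c = f a (f b c))"

definition subsemigroup :: "'a set \<Rightarrow> 'a set \<Rightarrow> ('a \<Rightarrow> 'a \<Rightarrow> 'a) \<Rightarrow> bool" where
  "subsemigroup R S f \<longleftrightarrow> semigroup_on S f \<and> R \<subseteq> S \<and> semigroup_on R f"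

definition inverse_semigroup :: "'a set \<Rightarrow> ('a \<Rightarrow> 'a \<Rightarrow> 'a) \<Rightarrow> bool" where
  "inverse_semigroup S f \<longleftrightarrow> semigroup_on S f \<and>
     (\<forall>a\<in>S. \<exists>!b. b \<in> S \<and> f (f a b) a = a \<and> f (f b a) b = b)"

definition semigroup_congruence :: "'a set \<Rightarrow> ('a \<Rightarrow> 'a \<Rightarrow> 'a) \<Rightarrow> 'a rel \<Rightarrow> bool" where
  "semigroup_congruence S f \<rho> \<longleftrightarrow> equiv S \<rho> \<and>
     (\<forall>a b c d. (a, b) \<in> \<rho> \<longrightarrow> (c, d) \<in> \<rho> \<longrightarrow> (f a c, f b d) \<in> \<rho>)"

text \<open>The principal one-sided ideals \<open>S\<^sup>1a\<close> and \<open>aS\<^sup>1\<close>.\<close>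

definition left_ideal :: "'a set \<Rightarrow> ('a \<Rightarrow> 'a \<Rightarrow> 'a) \<Rightarrow> 'a \<Rightarrow> 'a set" where
  "left_ideal S f a = insert a {f x a | x. x \<in> S}"

definition right_ideal :: "'a set \<Rightarrow> ('a \<Rightarrow> 'a \<Rightarrow> 'a) \<Rightarrow> 'a \<Rightarrow> 'a set" where
  "right_ideal S f a = insert a {f a x | x. x \<in> S}"

definition green_L :: "'a set \<Rightarrow> ('a \<Rightarrow> 'a \<Rightarrow> 'a) \<Rightarrow> 'a rel" where
  "green_L S f = {(a, b). a \<in> S \<and> b \<in> S \<and> left_ideal S f a = left_ideal S f b}"

definition green_R :: "'a set \<Rightarrow> ('a \<Rightarrow> 'a \<Rightarrow> 'a) \<Rightarrow> 'a rel" where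
  "green_R S f = {(a, b). a \<in> S \<and> b \<in> S \<and> right_ideal S f a = right_ideal S f b}"

definition green_H :: "'a set \<Rightarrow> ('a \<Rightarrow> 'a \<Rightarrow> 'a) \<Rightarrow> 'a rel" where
  "green_H S f = green_L S f \<inter> green_R S f"

definition fundamental_semigroup :: "'a set \<Rightarrow> ('a \<Rightarrow> 'a \<Rightarrow> 'a) \<Rightarrow> bool" where
  "fundamental_semigroup S f \<longleftrightarrow> semigroup_on S f \<and>
     (\<forall>\<rho>. semigroup_congruence S f \<rho> \<and> \<rho> \<subseteq> green_H S f \<longrightarrow> \<rho> = Id_on S)"


section \<open>Networks\<close>

record ('v, 't) pre_network =
  verts :: "'v set"
  rels :: "'t set"
  src :: "'t \<Rightarrow> 'v set"
  rng :: "'t \<Rightarrow> 'v set"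

locale network =
  fixes \<Gamma> :: "('v, 't) pre_network"
  assumes countable_verts: "countable (verts \<Gamma>)"
    and countable_rels: "countable (rels \<Gamma>)"
    and src_subset: "t \<in> rels \<Gamma> \<Longrightarrow> src \<Gamma> t \<subseteq> verts \<Gamma>"
    and rng_subset: "t \<in> rels \<Gamma> \<Longrightarrow> rng \<Gamma> t \<subseteq> verts \<Gamma>"
    and src_nonempty: "t \<in> rels \<Gamma> \<Longrightarrow> src \<Gamma> t \<noteq> {}"
    and rng_nonempty: "t \<in> rels \<Gamma> \<Longrightarrow> rng \<Gamma> t \<noteq> {}"
    and src_rng_disjoint: "t \<in> rels \<Gamma> \<Longrightarrow> src \<Gamma> t \<inter> rng \<Gamma> t = {}"

text \<open>The set \<open>T\<^sup>0\<close>; a vertex \<open>v\<close> is identified with the singleton \<open>{v}\<close>.\<close>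

definition T0 :: "('v, 't) pre_network \<Rightarrow> 'v set set" where
  "T0 \<Gamma> = src \<Gamma> ` rels \<Gamma> \<union> rng \<Gamma> ` rels \<Gamma> \<union> (\<lambda>v. {v}) ` verts \<Gamma>"

text \<open>\<open>Rel t\<close>, \<open>Obj A\<close>, \<open>Inv t\<close> and \<open>Zero\<close> are the symbols \<open>t\<close>, \<open>A\<close>, \<open>t\<^sup>-\<^sup>1\<close> and \<open>0\<close>.\<close>

datatype ('v, 't) symb = Rel 't | Obj "'v set" | Inv 't | Zero

definition pos_symbs :: "('v, 't) pre_network \<Rightarrow> ('v, 't) symb set" where
  "pos_symbs \<Gamma> = Rel ` rels \<Gamma> \<union> Obj ` T0 \<Gamma>"

definition nz_symbs :: "('v, 't) pre_network \<Rightarrow> ('v, 't) symb set" where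
  "nz_symbs \<Gamma> = Rel ` rels \<Gamma> \<union> Obj ` T0 \<Gamma> \<union> Inv ` rels \<Gamma>"

definition symbs :: "('v, 't) pre_network \<Rightarrow> ('v, 't) symb set" where
  "symbs \<Gamma> = nz_symbs \<Gamma> \<union> {Zero}"

text \<open>The values at \<open>Zero\<close> are dummies; source and range are only ever taken of
  non-zero symbols.\<close>

fun symb_src :: "('v, 't) pre_network \<Rightarrow> ('v, 't) symb \<Rightarrow> 'v set" where
  "symb_src \<Gamma> (Rel t) = src \<Gamma> t"
| "symb_src \<Gamma> (Obj A) = A"
| "symb_src \<Gamma> (Inv t) = rng \<Gamma> t"
| "symb_src \<Gamma> Zero = {}"

fun symb_rng :: "('v, 't) pre_network \<Rightarrow> ('v, 't) symb \<Rightarrow> 'v set" where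
  "symb_rng \<Gamma> (Rel t) = rng \<Gamma> t"
| "symb_rng \<Gamma> (Obj A) = A"
| "symb_rng \<Gamma> (Inv t) = src \<Gamma> t"
| "symb_rng \<Gamma> Zero = {}"

fun symb_inv :: "('v, 't) symb \<Rightarrow> ('v, 't) symb" where
  "symb_inv (Rel t) = Inv t"
| "symb_inv (Obj A) = Obj A"
| "symb_inv (Inv t) = Rel t"
| "symb_inv Zero = Zero"


section \<open>The semigroup \<open>Q\<^sub>\<Gamma>\<close>\<close>

inductive_set nrels :: "('v, 't) pre_network \<Rightarrow> ('v, 't) symb list rel"
  for \<Gamma> :: "('v, 't) pre_network" where
  NR1_src: "x \<in> nz_symbs \<Gamma> \<Longrightarrow> ([Obj (symb_src \<Gamma> x), x], [x]) \<in> nrels \<Gamma>"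
| NR1_rng: "x \<in> nz_symbs \<Gamma> \<Longrightarrow> ([x, Obj (symb_rng \<Gamma> x)], [x]) \<in> nrels \<Gamma>"
| NR2: "x \<in> nz_symbs \<Gamma> \<Longrightarrow> y \<in> nz_symbs \<Gamma> \<Longrightarrow> symb_rng \<Gamma> x \<inter> symb_src \<Gamma> y = {} \<Longrightarrow>
    ([x, y], [Zero]) \<in> nrels \<Gamma>"
| NR3: "t \<in> rels \<Gamma> \<Longrightarrow> u \<in> rels \<Gamma> \<Longrightarrow> t \<noteq> u \<Longrightarrow> ([Inv t, Rel u], [Zero]) \<in> nrels \<Gamma>"
| NR4: "t \<in> rels \<Gamma> \<Longrightarrow> ([Inv t, Rel t], [Obj (rng \<Gamma> t)]) \<in> nrels \<Gamma>"
| NR5: "t \<in> rels \<Gamma> \<Longrightarrow> A \<in> T0 \<Gamma> \<Longrightarrow> src \<Gamma> t \<noteq> A \<Longrightarrow> ([Inv t, Obj A], [Zero]) \<in> nrels \<Gamma>"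
| NR6_left: "x \<in> symbs \<Gamma> \<Longrightarrow> ([Zero, x], [Zero]) \<in> nrels \<Gamma>"
| NR6_right: "x \<in> symbs \<Gamma> \<Longrightarrow> ([x, Zero], [Zero]) \<in> nrels \<Gamma>"

text \<open>The free semigroup on the symbols consists of the non-empty words under
  concatenation; \<open>Qcong \<Gamma>\<close> is the least congruence on it containing the defining
  relations.\<close>

definition nwords :: "('v, 't) pre_network \<Rightarrow> ('v, 't) symb list set" where
  "nwords \<Gamma> = {w. w \<noteq> [] \<and> set w \<subseteq> symbs \<Gamma>}"

definition Qcong :: "('v, 't) pre_network \<Rightarrow> ('v, 't) symb list rel" where
  "Qcong \<Gamma> = \<Inter>{\<rho>. semigroup_congruence (nwords \<Gamma>) (@) \<rho> \<and> nrels \<Gamma> \<subseteq> \<rho>}"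

definition Q_net :: "('v, 't) pre_network \<Rightarrow> ('v, 't) symb list set set" where
  "Q_net \<Gamma> = nwords \<Gamma> // Qcong \<Gamma>"

definition cls :: "('v, 't) pre_network \<Rightarrow> ('v, 't) symb list \<Rightarrow> ('v, 't) symb list set" where
  "cls \<Gamma> w = Qcong \<Gamma> `` {w}"

definition Qmult :: "('v, 't) pre_network \<Rightarrow> ('v, 't) symb list set \<Rightarrow>
    ('v, 't) symb list set \<Rightarrow> ('v, 't) symb list set" where
  "Qmult \<Gamma> a b = (\<Union>u\<in>a. \<Union>v\<in>b. cls \<Gamma> (u @ v))"


text \<open>\<open>Qcong \<Gamma>\<close> is indeed a congruence containing the relations, and \<open>Qmult \<Gamma>\<close> is the
  induced product of classes.\<close>

lemma nwords_append: "u \<in> nwords \<Gamma> \<Longrightarrow> v \<in> nwords \<Gamma> \<Longrightarrow> u @ v \<in> nwords \<Gamma>"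
  by (auto simp: nwords_def)

lemma symb_src_T0: "x \<in> nz_symbs \<Gamma> \<Longrightarrow> symb_src \<Gamma> x \<in> T0 \<Gamma>"
  by (auto simp: nz_symbs_def T0_def)

lemma symb_rng_T0: "x \<in> nz_symbs \<Gamma> \<Longrightarrow> symb_rng \<Gamma> x \<in> T0 \<Gamma>"
  by (auto simp: nz_symbs_def T0_def)

lemma nrels_nwords: "nrels \<Gamma> \<subseteq> nwords \<Gamma> \<times> nwords \<Gamma>"
proof (rule subrelI)
  fix u v assume "(u, v) \<in> nrels \<Gamma>"
  then show "(u, v) \<in> nwords \<Gamma> \<times> nwords \<Gamma>"
  proof cases
    case NR1_src
    then show ?thesis using symb_src_T0[of _ \<Gamma>] by (auto simp: nwords_def symbs_def nz_symbs_def)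
  next
    case NR1_rng
    then show ?thesis using symb_rng_T0[of _ \<Gamma>] by (auto simp: nwords_def symbs_def nz_symbs_def)
  qed (auto simp: nwords_def symbs_def nz_symbs_def T0_def)
qed

lemma semigroup_congruence_Qcong: "semigroup_congruence (nwords \<Gamma>) (@) (Qcong \<Gamma>)"
proof -
  let ?C = "{\<rho>. semigroup_congruence (nwords \<Gamma>) (@) \<rho> \<and> nrels \<Gamma> \<subseteq> \<rho>}"
  have "nwords \<Gamma> \<times> nwords \<Gamma> \<in> ?C"
    using nrels_nwords[of \<Gamma>]
    by (auto simp: semigroup_congruence_def nwords_append
        intro!: equivI refl_onI symI transI)
  then have sub: "Qcong \<Gamma> \<subseteq> nwords \<Gamma> \<times> nwords \<Gamma>"
    unfolding Qcong_def by blast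
  have eq: "equiv (nwords \<Gamma>) \<rho>"
    and mul: "(a, b) \<in> \<rho> \<Longrightarrow> (c, d) \<in> \<rho> \<Longrightarrow> (a @ c, b @ d) \<in> \<rho>"
    if "\<rho> \<in> ?C" for \<rho> a b c d
    using that by (auto simp: semigroup_congruence_def)
  have "equiv (nwords \<Gamma>) (Qcong \<Gamma>)"
  proof (rule equivI)
    show "Qcong \<Gamma> \<subseteq> nwords \<Gamma> \<times> nwords \<Gamma>" by (rule sub)
    show "refl_on (nwords \<Gamma>) (Qcong \<Gamma>)"
    proof (rule refl_onI)
      fix x assume "x \<in> nwords \<Gamma>"
      then have "(x, x) \<in> \<rho>" if "\<rho> \<in> ?C" for \<rho>
        using eq[OF that] by (meson equivE refl_onD)
      then show "(x, x) \<in> Qcong \<Gamma>" unfolding Qcong_def by blast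
    qed
    show "sym (Qcong \<Gamma>)"
    proof (rule symI)
      fix x y assume "(x, y) \<in> Qcong \<Gamma>"
      then have "(y, x) \<in> \<rho>" if "\<rho> \<in> ?C" for \<rho>
        using eq[OF that] that unfolding Qcong_def by (meson InterD equivE symD)
      then show "(y, x) \<in> Qcong \<Gamma>" unfolding Qcong_def by blast
    qed
    show "trans (Qcong \<Gamma>)"
    proof (rule transI)
      fix x y z assume "(x, y) \<in> Qcong \<Gamma>" "(y, z) \<in> Qcong \<Gamma>"
      then have "(x, z) \<in> \<rho>" if "\<rho> \<in> ?C" for \<rho>
        using eq[OF that] that unfolding Qcong_def by (meson InterD equivE transD)
      then show "(x, z) \<in> Qcong \<Gamma>" unfolding Qcong_def by blast
    qed
  qed
  moreover have "\<forall>a b c d. (a, b) \<in> Qcong \<Gamma> \<longrightarrow> (c, d) \<in> Qcong \<Gamma> \<longrightarrow> (a @ c, b @ d) \<in> Qcong \<Gamma>"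
    unfolding Qcong_def using mul by blast
  ultimately show ?thesis by (simp add: semigroup_congruence_def)
qed

lemma nrels_Qcong: "nrels \<Gamma> \<subseteq> Qcong \<Gamma>"
  unfolding Qcong_def by blast

lemma Qmult_cls:
  assumes "u \<in> nwords \<Gamma>" "v \<in> nwords \<Gamma>"
  shows "Qmult \<Gamma> (cls \<Gamma> u) (cls \<Gamma> v) = cls \<Gamma> (u @ v)"
proof -
  have eq: "equiv (nwords \<Gamma>) (Qcong \<Gamma>)"
    and mul: "\<And>a b c d. (a, b) \<in> Qcong \<Gamma> \<Longrightarrow> (c, d) \<in> Qcong \<Gamma> \<Longrightarrow> (a @ c, b @ d) \<in> Qcong \<Gamma>"
    using semigroup_congruence_Qcong[of \<Gamma>] by (auto simp: semigroup_congruence_def)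
  have "cls \<Gamma> (x @ y) = cls \<Gamma> (u @ v)" if "x \<in> cls \<Gamma> u" "y \<in> cls \<Gamma> v" for x y
    using that mul[of u x v y] equiv_class_eq[OF eq] by (auto simp: cls_def)
  moreover have "u \<in> cls \<Gamma> u" "v \<in> cls \<Gamma> v"
    using assms equiv_class_self[OF eq] by (auto simp: cls_def)
  ultimately show ?thesis unfolding Qmult_def by blast
qed


section \<open>Paths and the semigroups \<open>S\<^sub>\<Gamma>\<close> and \<open>R\<^sub>\<Gamma>\<close>\<close>

definition nz_path :: "('v, 't) pre_network \<Rightarrow> ('v, 't) symb list \<Rightarrow> bool" where
  "nz_path \<Gamma> \<alpha> \<longleftrightarrow> \<alpha> \<noteq> [] \<and> set \<alpha> \<subseteq> pos_symbs \<Gamma> \<and>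
     successively (\<lambda>x y. symb_rng \<Gamma> x \<inter> symb_src \<Gamma> y \<noteq> {}) \<alpha>"

definition linear_path :: "('v, 't) pre_network \<Rightarrow> ('v, 't) symb list \<Rightarrow> bool" where
  "linear_path \<Gamma> \<alpha> \<longleftrightarrow> nz_path \<Gamma> \<alpha> \<and>
     successively (\<lambda>x y. symb_rng \<Gamma> x = symb_src \<Gamma> y) \<alpha>"

definition reduced_path :: "('v, 't) pre_network \<Rightarrow> ('v, 't) symb list \<Rightarrow> bool" where
  "reduced_path \<Gamma> \<alpha> \<longleftrightarrow> nz_path \<Gamma> \<alpha> \<and>
     successively (\<lambda>x y. x \<noteq> Obj (symb_src \<Gamma> y) \<and> y \<noteq> Obj (symb_rng \<Gamma> x)) \<alpha>"

definition path_rng :: "('v, 't) pre_network \<Rightarrow> ('v, 't) symb list \<Rightarrow> 'v set" where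
  "path_rng \<Gamma> \<alpha> = symb_rng \<Gamma> (last \<alpha>)"

definition path_inv :: "('v, 't) symb list \<Rightarrow> ('v, 't) symb list" where
  "path_inv \<alpha> = rev (map symb_inv \<alpha>)"

definition RP :: "('v, 't) pre_network \<Rightarrow> ('v, 't) symb list set" where
  "RP \<Gamma> = {\<alpha>. reduced_path \<Gamma> \<alpha>} \<union> {[Zero]}"

definition RLP :: "('v, 't) pre_network \<Rightarrow> ('v, 't) symb list set" where
  "RLP \<Gamma> = {\<alpha>. reduced_path \<Gamma> \<alpha> \<and> linear_path \<Gamma> \<alpha>}"

text \<open>The elements of \<open>T\<^sup>0\<close>, viewed as paths of length one.\<close>

definition T0_paths :: "('v, 't) pre_network \<Rightarrow> ('v, 't) symb list set" where
  "T0_paths \<Gamma> = (\<lambda>A. [Obj A]) ` T0 \<Gamma>"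

definition S_net :: "('v, 't) pre_network \<Rightarrow> ('v, 't) symb list set set" where
  "S_net \<Gamma> = {q \<in> Q_net \<Gamma>. \<exists>\<alpha> \<beta>. \<alpha> \<in> RP \<Gamma> - {[Zero]} \<and> \<beta> \<in> RLP \<Gamma> - T0_paths \<Gamma> \<and>
       path_rng \<Gamma> \<alpha> = path_rng \<Gamma> \<beta> \<and> q = cls \<Gamma> (\<alpha> @ path_inv \<beta>)} \<union> {cls \<Gamma> [Zero]}"

definition R_net :: "('v, 't) pre_network \<Rightarrow> ('v, 't) symb list set set" where
  "R_net \<Gamma> = {q \<in> S_net \<Gamma>. \<exists>\<alpha> \<beta>. \<alpha> \<in> RLP \<Gamma> - T0_paths \<Gamma> \<and> \<beta> \<in> RLP \<Gamma> - T0_paths \<Gamma> \<and>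
       path_rng \<Gamma> \<alpha> = path_rng \<Gamma> \<beta> \<and> q = cls \<Gamma> (\<alpha> @ path_inv \<beta>)} \<union> {cls \<Gamma> [Zero]}"

end

theory Submission
  imports Defs
begin

text \<open>
  Write a linear reduced path that is not a vertex set as a non-empty list of relations; then the
  elements of \<open>R\<^sub>\<Gamma>\<close> are \<open>0\<close> and the classes of \<open>a b\<^sup>-\<^sup>1\<close>, where \<open>a\<close> and \<open>b\<close> are such lists with a
  common range.

  The closure of \<open>S\<^sub>\<Gamma>\<close> and \<open>R\<^sub>\<Gamma>\<close> under products rests on one computation, \<open>cancel\<close>: a product
  \<open>b\<^sup>-\<^sup>1 g\<close> with \<open>g\<close> a path either vanishes, or one factor absorbs the other, and what is left is a path
  or the inverse of a linear path. The resulting word \<open>\<alpha> b\<^sup>-\<^sup>1\<close> has the right shape except that \<open>\<alpha>\<close>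
  need not be reduced; \<open>ex_reduced_path\<close> repairs this.

  The rest needs to know that different pairs \<open>(a, b)\<close> give different non-zero classes. For this \<open>Q\<^sub>\<Gamma>\<close>
  is represented by relations on pairs \<open>(A, p)\<close>, to be read as a path \<open>p\<close> that starts at
  the vertex set \<open>A\<close>: a relation \<open>t\<close> is prefixed to the paths that start at its range, \<open>t\<^sup>-\<^sup>1\<close> undoes
  this, and a vertex set \<open>B\<close> fixes the paths that start at \<open>B\<close>. In this representation source and range
  of consecutive symbols must be equal, not merely meet, so in general it is not faithful on
  \<open>Q\<^sub>\<Gamma>\<close>. It is faithful on \<open>R\<^sub>\<Gamma>\<close>, because \<open>a b\<^sup>-\<^sup>1\<close> acts as the partial injection \<open>b \<xi> \<mapsto> a \<xi>\<close>, whose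
  domain determines \<open>b\<close> and whose range determines \<open>a\<close>.

  Thus \<open>R\<^sub>\<Gamma>\<close> is, up to isomorphism, a semigroup of partial injections which contains the converse
  \<open>b a\<^sup>-\<^sup>1\<close> of each of its elements \<open>a b\<^sup>-\<^sup>1\<close>, so it is inverse. Elements related by \<open>\<L>\<close> have equal domains and elements related
  by \<open>\<R>\<close> have equal ranges, so \<open>\<H>\<close> is the identity on \<open>R\<^sub>\<Gamma>\<close>. This is more than being fundamental.
\<close>

section \<open>Classes of words\<close>

lemma equiv_Qcong: "equiv (nwords \<Gamma>) (Qcong \<Gamma>)"
  using semigroup_congruence_Qcong by (auto simp: semigroup_congruence_def)

lemma cls_nrels: "(u, v) \<in> nrels \<Gamma> \<Longrightarrow> cls \<Gamma> u = cls \<Gamma> v"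
  using nrels_Qcong[of \<Gamma>] equiv_class_eq[OF equiv_Qcong] unfolding cls_def by blast

lemma cls_append_cong:
  assumes "cls \<Gamma> u = cls \<Gamma> u'" "cls \<Gamma> v = cls \<Gamma> v'"
    and "u \<in> nwords \<Gamma>" "u' \<in> nwords \<Gamma>" "v \<in> nwords \<Gamma>" "v' \<in> nwords \<Gamma>"
  shows "cls \<Gamma> (u @ v) = cls \<Gamma> (u' @ v')"
  using assms Qmult_cls by metis

lemma cls_context:
  assumes "cls \<Gamma> u = cls \<Gamma> v" "u \<in> nwords \<Gamma>" "v \<in> nwords \<Gamma>"
    and "set x \<subseteq> symbs \<Gamma>" "set y \<subseteq> symbs \<Gamma>"
  shows "cls \<Gamma> (x @ u @ y) = cls \<Gamma> (x @ v @ y)"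
proof -
  have "cls \<Gamma> (u @ y) = cls \<Gamma> (v @ y) \<and> u @ y \<in> nwords \<Gamma> \<and> v @ y \<in> nwords \<Gamma>"
    using assms cls_append_cong[of \<Gamma> u v y y] by (cases "y = []") (auto simp: nwords_def)
  then show ?thesis
    using assms(4) cls_append_cong[of \<Gamma> x x "u @ y" "v @ y"]
    by (cases "x = []") (auto simp: nwords_def)
qed

lemma cls_context_nrels:
  assumes "(u, v) \<in> nrels \<Gamma>" "set x \<subseteq> symbs \<Gamma>" "set y \<subseteq> symbs \<Gamma>"
  shows "cls \<Gamma> (x @ u @ y) = cls \<Gamma> (x @ v @ y)"
  using cls_context[OF cls_nrels[OF assms(1)] _ _ assms(2,3)] assms(1) nrels_nwords by blast

lemma Zero_nwords: "[Zero] \<in> nwords \<Gamma>"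
  by (simp add: nwords_def symbs_def)

lemma cls_Zero_left: "set y \<subseteq> symbs \<Gamma> \<Longrightarrow> cls \<Gamma> (Zero # y) = cls \<Gamma> [Zero]"
proof (induction y)
  case (Cons x y)
  then have "cls \<Gamma> ([] @ [Zero, x] @ y) = cls \<Gamma> ([] @ [Zero] @ y)"
    by (intro cls_context_nrels NR6_left) auto
  with Cons show ?case by auto
qed simp

lemma cls_Zero_right: "set x \<subseteq> symbs \<Gamma> \<Longrightarrow> cls \<Gamma> (x @ [Zero]) = cls \<Gamma> [Zero]"
proof (induction x rule: rev_induct)
  case (snoc y x)
  then have "cls \<Gamma> (x @ [y, Zero] @ []) = cls \<Gamma> (x @ [Zero] @ [])"
    by (intro cls_context_nrels NR6_right) auto
  with snoc show ?case by auto
qed simp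

lemma cls_Zero_mid:
  assumes "set x \<subseteq> symbs \<Gamma>" "set y \<subseteq> symbs \<Gamma>"
  shows "cls \<Gamma> (x @ Zero # y) = cls \<Gamma> [Zero]"
proof -
  have "cls \<Gamma> (x @ (Zero # y) @ []) = cls \<Gamma> (x @ [Zero] @ [])"
    using assms by (intro cls_context cls_Zero_left) (auto simp: nwords_def symbs_def)
  with cls_Zero_right[OF assms(1)] show ?thesis by simp
qed

lemma cls_context_zero:
  assumes "cls \<Gamma> u = cls \<Gamma> [Zero]" "u \<in> nwords \<Gamma>" "set x \<subseteq> symbs \<Gamma>" "set y \<subseteq> symbs \<Gamma>"
  shows "cls \<Gamma> (x @ u @ y) = cls \<Gamma> [Zero]"
  using cls_context[OF assms(1,2) Zero_nwords assms(3,4)] cls_Zero_mid[OF assms(3,4)] by simp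

lemma cls_Q_net: "w \<in> nwords \<Gamma> \<Longrightarrow> cls \<Gamma> w \<in> Q_net \<Gamma>"
  by (auto simp: cls_def Q_net_def quotientI)

lemma Q_net_cls: "q \<in> Q_net \<Gamma> \<Longrightarrow> \<exists>w \<in> nwords \<Gamma>. q = cls \<Gamma> w"
  by (auto simp: cls_def Q_net_def elim!: quotientE)

lemma Qmult_closed: "a \<in> Q_net \<Gamma> \<Longrightarrow> b \<in> Q_net \<Gamma> \<Longrightarrow> Qmult \<Gamma> a b \<in> Q_net \<Gamma>"
  using Q_net_cls Qmult_cls cls_Q_net nwords_append by metis

lemma Qmult_assoc:
  assumes "a \<in> Q_net \<Gamma>" "b \<in> Q_net \<Gamma>" "c \<in> Q_net \<Gamma>"
  shows "Qmult \<Gamma> (Qmult \<Gamma> a b) c = Qmult \<Gamma> a (Qmult \<Gamma> b c)"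
proof -
  obtain u v w where "u \<in> nwords \<Gamma>" "v \<in> nwords \<Gamma>" "w \<in> nwords \<Gamma>"
    "a = cls \<Gamma> u" "b = cls \<Gamma> v" "c = cls \<Gamma> w"
    using assms Q_net_cls by metis
  then show ?thesis by (simp add: Qmult_cls nwords_append)
qed

lemma semigroup_on_Q_subset:
  assumes "S \<subseteq> Q_net \<Gamma>" "S \<noteq> {}" "\<And>a b. a \<in> S \<Longrightarrow> b \<in> S \<Longrightarrow> Qmult \<Gamma> a b \<in> S"
  shows "semigroup_on S (Qmult \<Gamma>)"
  unfolding semigroup_on_def using assms Qmult_assoc by (meson subsetD)

section \<open>Paths and their reduced forms\<close>

lemma pos_nz: "x \<in> pos_symbs \<Gamma> \<Longrightarrow> x \<in> nz_symbs \<Gamma>"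
  by (auto simp: pos_symbs_def nz_symbs_def)

lemma nz_symbs_symbs: "x \<in> nz_symbs \<Gamma> \<Longrightarrow> x \<in> symbs \<Gamma>"
  by (auto simp: symbs_def)

lemma Obj_pos: "A \<in> T0 \<Gamma> \<Longrightarrow> Obj A \<in> pos_symbs \<Gamma>"
  by (auto simp: pos_symbs_def)

lemma nz_path_symbs: "nz_path \<Gamma> p \<Longrightarrow> set p \<subseteq> symbs \<Gamma>"
  by (auto simp: nz_path_def dest!: subsetD intro: pos_nz nz_symbs_symbs)

lemma nz_path_nwords: "nz_path \<Gamma> p \<Longrightarrow> p \<in> nwords \<Gamma>"
  using nz_path_symbs by (auto simp: nwords_def nz_path_def)

lemma nz_path_Cons:
  "nz_path \<Gamma> (x # p) \<longleftrightarrow> x \<in> pos_symbs \<Gamma> \<and>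
    (p \<noteq> [] \<longrightarrow> symb_rng \<Gamma> x \<inter> symb_src \<Gamma> (hd p) \<noteq> {} \<and> nz_path \<Gamma> p)"
  by (cases p) (auto simp: nz_path_def)

lemma nz_path_append:
  assumes "p \<noteq> []" "q \<noteq> []"
  shows "nz_path \<Gamma> (p @ q) \<longleftrightarrow> nz_path \<Gamma> p \<and> nz_path \<Gamma> q \<and> path_rng \<Gamma> p \<inter> symb_src \<Gamma> (hd q) \<noteq> {}"
  using assms by (auto simp: nz_path_def successively_append_iff path_rng_def)

lemma linear_path_append:
  assumes "p \<noteq> []" "q \<noteq> []" "linear_path \<Gamma> p" "linear_path \<Gamma> q"
    "path_rng \<Gamma> p = symb_src \<Gamma> (hd q)" "symb_src \<Gamma> (hd q) \<noteq> {}"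
  shows "linear_path \<Gamma> (p @ q)"
  using assms nz_path_append[of p q \<Gamma>]
  by (auto simp: linear_path_def successively_append_iff path_rng_def)

lemma linear_path_Cons:
  "linear_path \<Gamma> (x # p) \<longleftrightarrow> nz_path \<Gamma> (x # p) \<and>
    (p \<noteq> [] \<longrightarrow> symb_rng \<Gamma> x = symb_src \<Gamma> (hd p) \<and> linear_path \<Gamma> p)"
  by (cases p) (auto simp: linear_path_def nz_path_Cons)

lemma reduced_path_Cons:
  "reduced_path \<Gamma> (x # p) \<longleftrightarrow> nz_path \<Gamma> (x # p) \<and>
    (p \<noteq> [] \<longrightarrow> x \<noteq> Obj (symb_src \<Gamma> (hd p)) \<and> hd p \<noteq> Obj (symb_rng \<Gamma> x) \<and> reduced_path \<Gamma> p)"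
  by (cases p) (auto simp: reduced_path_def nz_path_Cons)

text \<open>
  A path is reduced from its end: in front of a reduced path \<open>q\<close>, a new symbol \<open>x\<close> either is redundant,
  or makes the first symbol of \<open>q\<close> redundant, or is compatible with it. In the second case the first
  symbol of \<open>q\<close> is the range of \<open>x\<close>, and since \<open>q\<close> is reduced, \<open>x\<close> is compatible with the
  next one. Linearity and the occurring relations are recorded because they decide whether the
  reduced path is a linear one outside \<open>T\<^sup>0\<close>.
\<close>

lemma ex_reduced_path:
  assumes "nz_path \<Gamma> p"
  shows "\<exists>q. reduced_path \<Gamma> q \<and> cls \<Gamma> q = cls \<Gamma> p \<and> symb_src \<Gamma> (hd q) = symb_src \<Gamma> (hd p) \<and>
    path_rng \<Gamma> q = path_rng \<Gamma> p \<and> (linear_path \<Gamma> p \<longrightarrow> linear_path \<Gamma> q) \<and> Rel -` set q = Rel -` set p"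
  using assms
proof (induction p)
  case Nil
  then show ?case by (simp add: nz_path_def)
next
  case (Cons x p)
  show ?case
  proof (cases "p = []")
    case True
    with Cons.prems show ?thesis
      by (intro exI[of _ "[x]"]) (auto simp: reduced_path_def)
  next
    case False
    with Cons.prems have x: "x \<in> pos_symbs \<Gamma>" and ne: "symb_rng \<Gamma> x \<inter> symb_src \<Gamma> (hd p) \<noteq> {}"
      and p: "nz_path \<Gamma> p" by (auto simp: nz_path_Cons)
    from Cons.IH[OF p] obtain q where q: "reduced_path \<Gamma> q" "cls \<Gamma> q = cls \<Gamma> p"
      "symb_src \<Gamma> (hd q) = symb_src \<Gamma> (hd p)" "path_rng \<Gamma> q = path_rng \<Gamma> p"
      "linear_path \<Gamma> p \<Longrightarrow> linear_path \<Gamma> q" "Rel -` set q = Rel -` set p" by blast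
    have nq: "nz_path \<Gamma> q" "q \<noteq> []" using q(1) by (auto simp: reduced_path_def nz_path_def)
    have xs: "x \<in> symbs \<Gamma>" using x pos_nz nz_symbs_symbs by blast
    have xq: "nz_path \<Gamma> (x # q)" using x ne nq q(3) by (simp add: nz_path_Cons)
    have "cls \<Gamma> ([x] @ q @ []) = cls \<Gamma> ([x] @ p @ [])"
      using q(2) xs p nq by (intro cls_context nz_path_nwords) auto
    then have cxq: "cls \<Gamma> (x # q) = cls \<Gamma> (x # p)" by simp
    have rxq: "path_rng \<Gamma> (x # q) = path_rng \<Gamma> (x # p)"
      using q(4) nq(2) False by (simp add: path_rng_def)
    have lxq: "linear_path \<Gamma> (x # q)" if "linear_path \<Gamma> (x # p)"
      using that q(3,5) xq False nq by (simp add: linear_path_Cons)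
    have Rxq: "Rel -` set (x # q) = Rel -` set (x # p)" using q(6) by (auto simp: set_eq_iff)
    obtain y q' where qy: "q = y # q'" using nq by (cases q) auto
    have q's: "set q' \<subseteq> symbs \<Gamma>" using nz_path_symbs[OF nq(1)] qy by simp
    consider (drop_x) "x = Obj (symb_src \<Gamma> y)"
      | (drop_y) "x \<noteq> Obj (symb_src \<Gamma> y)" "y = Obj (symb_rng \<Gamma> x)"
      | (keep) "x \<noteq> Obj (symb_src \<Gamma> y)" "y \<noteq> Obj (symb_rng \<Gamma> x)" by blast
    then show ?thesis
    proof cases
      case drop_x
      have "cls \<Gamma> ([] @ [Obj (symb_src \<Gamma> y), y] @ q') = cls \<Gamma> ([] @ [y] @ q')"
        using nq(1) qy q's by (intro cls_context_nrels NR1_src pos_nz) (auto simp: nz_path_Cons)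
      then have "cls \<Gamma> (x # q) = cls \<Gamma> q" using drop_x qy by simp
      then show ?thesis
        using q(1) cxq rxq lxq Rxq drop_x qy nq
        by (intro exI[of _ q]) (auto simp: path_rng_def linear_path_Cons)
    next
      case drop_y
      have "cls \<Gamma> ([] @ [x, Obj (symb_rng \<Gamma> x)] @ q') = cls \<Gamma> ([] @ [x] @ q')"
        using x q's by (intro cls_context_nrels NR1_rng pos_nz) auto
      then have c: "cls \<Gamma> (x # q') = cls \<Gamma> (x # p)" using drop_y qy cxq by simp
      have n: "nz_path \<Gamma> (x # q')" using x nq drop_y qy by (auto simp: nz_path_Cons)
      have red: "reduced_path \<Gamma> (x # q')"
        using q(1) n drop_y unfolding qy by (auto simp: reduced_path_Cons)
      have r: "path_rng \<Gamma> (x # q') = path_rng \<Gamma> (x # p)"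
        using rxq qy drop_y by (auto simp: path_rng_def)
      have l: "linear_path \<Gamma> (x # q')" if "linear_path \<Gamma> (x # p)"
        using lxq[OF that] drop_y n unfolding qy by (auto simp: linear_path_Cons)
      have "Rel -` set (x # q') = Rel -` set (x # p)"
        using Rxq drop_y qy by (auto simp: set_eq_iff)
      with c red r l show ?thesis by (intro exI[of _ "x # q'"]) auto
    next
      case keep
      then have "reduced_path \<Gamma> (x # q)" using xq q(1) qy by (simp add: reduced_path_Cons)
      with cxq rxq lxq Rxq show ?thesis by (intro exI[of _ "x # q"]) auto
    qed
  qed
qed

section \<open>Linear paths as lists of relations\<close>

definition lin_rels :: "('v, 't) pre_network \<Rightarrow> 't list \<Rightarrow> bool" where
  "lin_rels \<Gamma> a \<longleftrightarrow> a \<noteq> [] \<and> set a \<subseteq> rels \<Gamma> \<and> successively (\<lambda>t u. rng \<Gamma> t = src \<Gamma> u) a"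

definition inv_word :: "'t list \<Rightarrow> ('v, 't) symb list" where
  "inv_word b = rev (map Inv b)"

lemma inv_word_simps [simp]:
  "inv_word [] = []" "inv_word (t # b) = inv_word b @ [Inv t]"
  "inv_word (b @ c) = inv_word c @ inv_word b"
  by (simp_all add: inv_word_def)

lemma path_inv_Rel: "path_inv (map Rel b) = inv_word b"
  by (simp add: path_inv_def inv_word_def o_def)

lemma lin_rels_Cons:
  "lin_rels \<Gamma> (t # a) \<longleftrightarrow> t \<in> rels \<Gamma> \<and> (a \<noteq> [] \<longrightarrow> rng \<Gamma> t = src \<Gamma> (hd a) \<and> lin_rels \<Gamma> a)"
  by (cases a) (auto simp: lin_rels_def)

lemma lin_rels_append:
  assumes "lin_rels \<Gamma> a" "lin_rels \<Gamma> b" "rng \<Gamma> (last a) = src \<Gamma> (hd b)"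
  shows "lin_rels \<Gamma> (a @ b)"
  using assms by (auto simp: lin_rels_def successively_append_iff)

lemma lin_rels_last: "lin_rels \<Gamma> b \<Longrightarrow> last b \<in> rels \<Gamma>"
  unfolding lin_rels_def by (metis last_in_set subsetD)

lemma inv_word_symbs: "lin_rels \<Gamma> b \<Longrightarrow> set (inv_word b) \<subseteq> symbs \<Gamma>"
  by (auto simp: lin_rels_def inv_word_def symbs_def nz_symbs_def)

lemma inv_word_nwords: "lin_rels \<Gamma> b \<Longrightarrow> inv_word b \<in> nwords \<Gamma>"
  using inv_word_symbs by (auto simp: nwords_def inv_word_def lin_rels_def)

lemma path_rng_Rel: "a \<noteq> [] \<Longrightarrow> path_rng \<Gamma> (map Rel a) = rng \<Gamma> (last a)"
  by (simp add: path_rng_def last_map)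

context network
begin

lemma T0_nonempty: "A \<in> T0 \<Gamma> \<Longrightarrow> A \<noteq> {}"
  using src_nonempty rng_nonempty by (auto simp: T0_def)

lemma Rel_path:
  assumes "lin_rels \<Gamma> a"
  shows "nz_path \<Gamma> (map Rel a) \<and> linear_path \<Gamma> (map Rel a) \<and> reduced_path \<Gamma> (map Rel a)"
  using assms
proof (induction a)
  case (Cons t a)
  then show ?case
    by (cases a) (auto simp: lin_rels_Cons linear_path_Cons reduced_path_Cons nz_path_Cons
        pos_symbs_def src_nonempty linear_path_def reduced_path_def nz_path_def)
qed (simp add: lin_rels_def)

text \<open>
  A vertex set in a linear path equals the range of the symbol before it and the source of the symbol
  after it, so a linear path is reduced only if it has no vertex set or no other symbol.
\<close>

lemma RLP_cases:
  assumes "p \<in> RLP \<Gamma>"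
  shows "p \<in> T0_paths \<Gamma> \<or> (\<exists>a. lin_rels \<Gamma> a \<and> p = map Rel a)"
  using assms
proof (induction p)
  case Nil
  then show ?case by (simp add: RLP_def linear_path_def nz_path_def)
next
  case (Cons x p)
  then have red: "reduced_path \<Gamma> (x # p)" and lin: "linear_path \<Gamma> (x # p)"
    by (auto simp: RLP_def)
  have x: "x \<in> pos_symbs \<Gamma>" using lin by (simp add: linear_path_Cons nz_path_Cons)
  show ?case
  proof (cases "p = []")
    case True
    from x consider (rel) t where "t \<in> rels \<Gamma>" "x = Rel t" | (obj) A where "A \<in> T0 \<Gamma>" "x = Obj A"
      by (auto simp: pos_symbs_def)
    then show ?thesis
    proof cases
      case rel
      with True show ?thesis by (intro disjI2 exI[of _ "[t]"]) (simp add: lin_rels_def)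
    qed (use True in \<open>auto simp: T0_paths_def\<close>)
  next
    case False
    with red lin have p: "p \<in> RLP \<Gamma>" and r: "symb_rng \<Gamma> x = symb_src \<Gamma> (hd p)"
      and nr: "x \<noteq> Obj (symb_src \<Gamma> (hd p))" "hd p \<noteq> Obj (symb_rng \<Gamma> x)"
      by (auto simp: reduced_path_Cons linear_path_Cons RLP_def)
    have "p \<notin> T0_paths \<Gamma>" using r nr by (auto simp: T0_paths_def)
    with Cons.IH[OF p] obtain a where a: "lin_rels \<Gamma> a" "p = map Rel a" by blast
    from x nr r obtain t where t: "t \<in> rels \<Gamma>" "x = Rel t" by (auto simp: pos_symbs_def)
    from a t r show ?thesis
      by (intro disjI2 exI[of _ "t # a"]) (auto simp: lin_rels_Cons hd_map)
  qed
qed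

lemma RLP_minus_T0: "RLP \<Gamma> - T0_paths \<Gamma> = {map Rel a |a. lin_rels \<Gamma> a}"
proof -
  have "map Rel a \<notin> T0_paths \<Gamma>" for a :: "'t list"
    by (auto simp: T0_paths_def map_eq_Cons_conv)
  then show ?thesis using RLP_cases Rel_path by (auto simp: RLP_def)
qed

section \<open>Products of normal forms\<close>

lemma cls_inv_word_Obj:
  assumes "lin_rels \<Gamma> b" "set y \<subseteq> symbs \<Gamma>"
  shows "cls \<Gamma> (inv_word b @ Obj (src \<Gamma> (hd b)) # y) = cls \<Gamma> (inv_word b @ y)"
proof -
  obtain t b' where b: "b = t # b'" using assms by (cases b) (auto simp: lin_rels_def)
  have "Inv t \<in> nz_symbs \<Gamma>" using assms b by (auto simp: lin_rels_def nz_symbs_def)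
  from NR1_rng[OF this] have "cls \<Gamma> (inv_word b' @ [Inv t, Obj (src \<Gamma> t)] @ y)
      = cls \<Gamma> (inv_word b' @ [Inv t] @ y)"
    using assms b inv_word_symbs[OF assms(1)] by (intro cls_context_nrels) auto
  with b show ?thesis by simp
qed

text \<open>
  In each step the last symbol \<open>t\<^sup>-\<^sup>1\<close> of \<open>b\<^sup>-\<^sup>1\<close> meets the first symbol of \<open>g\<close>. Unless the product is
  \<open>0\<close>, that symbol is \<open>\<s>(t)\<close> and disappears, or it is \<open>t\<close> and cancels, leaving \<open>\<r>(t)\<close>; this is in
  turn absorbed by the rest of \<open>b\<^sup>-\<^sup>1\<close>, or starts the remaining path if \<open>b\<close> is used up.
\<close>

lemma cancel:
  assumes "lin_rels \<Gamma> b" "nz_path \<Gamma> g"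
  shows "cls \<Gamma> (inv_word b @ g) = cls \<Gamma> [Zero] \<or>
    (\<exists>p. nz_path \<Gamma> p \<and> symb_src \<Gamma> (hd p) = rng \<Gamma> (last b) \<and> path_rng \<Gamma> p = path_rng \<Gamma> g \<and>
       (linear_path \<Gamma> g \<longrightarrow> linear_path \<Gamma> p) \<and> cls \<Gamma> (inv_word b @ g) = cls \<Gamma> p) \<or>
    (\<exists>c. lin_rels \<Gamma> c \<and> rng \<Gamma> (last c) = rng \<Gamma> (last b) \<and> src \<Gamma> (hd c) = path_rng \<Gamma> g \<and>
       cls \<Gamma> (inv_word b @ g) = cls \<Gamma> (inv_word c))"
    (is "?zero b g \<or> ?path b g \<or> ?inv b g")
  using assms
proof (induction g arbitrary: b)
  case Nil
  then show ?case by (simp add: nz_path_def)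
next
  case (Cons x g)
  obtain t b' where b: "b = t # b'" using Cons.prems by (cases b) (auto simp: lin_rels_def)
  have t: "t \<in> rels \<Gamma>" using Cons.prems b by (simp add: lin_rels_Cons)
  have b's: "set (inv_word b') \<subseteq> symbs \<Gamma>" using inv_word_symbs[OF Cons.prems(1)] b by simp
  have gs: "set g \<subseteq> symbs \<Gamma>" using nz_path_symbs[OF Cons.prems(2)] by simp
  have x: "x \<in> pos_symbs \<Gamma>" using Cons.prems by (simp add: nz_path_Cons)
  have step: "cls \<Gamma> (inv_word b @ x # g) = cls \<Gamma> (inv_word b' @ [z] @ g)"
    if "([Inv t, x], [z]) \<in> nrels \<Gamma>" for z
    using cls_context_nrels[OF that b's gs] b by simp
  have zero: "?zero b (x # g)" if "([Inv t, x], [Zero]) \<in> nrels \<Gamma>"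
    using step[OF that] cls_Zero_mid[OF b's gs] by simp
  have absorbed: ?case
    if c: "lin_rels \<Gamma> c" "rng \<Gamma> (last c) = rng \<Gamma> (last b)" "src \<Gamma> (hd c) = symb_rng \<Gamma> x"
      "cls \<Gamma> (inv_word b @ x # g) = cls \<Gamma> (inv_word c @ g)" for c
  proof (cases "g = []")
    case True
    with c show ?thesis by (auto simp: path_rng_def)
  next
    case False
    then have "nz_path \<Gamma> g" "linear_path \<Gamma> (x # g) \<longrightarrow> linear_path \<Gamma> g"
      "path_rng \<Gamma> (x # g) = path_rng \<Gamma> g"
      using Cons.prems by (auto simp: nz_path_Cons linear_path_Cons path_rng_def)
    with Cons.IH[OF c(1)] c show ?thesis by auto
  qed
  from x consider (obj) A where "A \<in> T0 \<Gamma>" "x = Obj A" | (rel) u where "u \<in> rels \<Gamma>" "x = Rel u"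
    by (auto simp: pos_symbs_def)
  then show ?case
  proof cases
    case obj
    show ?thesis
    proof (cases "A = src \<Gamma> t")
      case True
      with cls_inv_word_Obj[OF Cons.prems(1) gs] obj b Cons.prems(1) show ?thesis
        by (intro absorbed[of b]) auto
    next
      case False
      with zero NR5[OF t obj(1)] obj show ?thesis by auto
    qed
  next
    case rel
    show ?thesis
    proof (cases "u = t")
      case True
      have c: "cls \<Gamma> (inv_word b @ x # g) = cls \<Gamma> (inv_word b' @ [Obj (rng \<Gamma> t)] @ g)"
        using step NR4[OF t] rel True by simp
      show ?thesis
      proof (cases "b' = []")
        case False
        then have "lin_rels \<Gamma> b'" "rng \<Gamma> t = src \<Gamma> (hd b')"
          using Cons.prems b by (auto simp: lin_rels_Cons)
        with c cls_inv_word_Obj[OF _ gs, of b'] False b rel True show ?thesis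
          by (intro absorbed[of b']) auto
      next
        case b': True
        have T: "rng \<Gamma> t \<in> T0 \<Gamma>" using t by (auto simp: T0_def)
        have "nz_path \<Gamma> (Obj (rng \<Gamma> t) # g)"
          using Cons.prems Obj_pos[OF T] rel True by (simp add: nz_path_Cons)
        moreover have "linear_path \<Gamma> (x # g) \<longrightarrow> linear_path \<Gamma> (Obj (rng \<Gamma> t) # g)"
          using calculation rel True by (simp add: linear_path_Cons)
        moreover have "path_rng \<Gamma> (Obj (rng \<Gamma> t) # g) = path_rng \<Gamma> (x # g)"
          using rel True by (simp add: path_rng_def)
        moreover have "cls \<Gamma> (inv_word b @ x # g) = cls \<Gamma> (Obj (rng \<Gamma> t) # g)"
          using c b' by simp
        ultimately have "?path b (x # g)"
          using b b' by (intro exI[of _ "Obj (rng \<Gamma> t) # g"]) simp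
        then show ?thesis by blast
      qed
    next
      case False
      with zero NR3[OF t rel(1)] rel show ?thesis by auto
    qed
  qed
qed

text \<open>
  In \<open>p b\<^sup>-\<^sup>1 q d\<^sup>-\<^sup>1\<close> a path left over from \<open>b\<^sup>-\<^sup>1 q\<close> extends \<open>p\<close>, and an inverse path extends \<open>d\<^sup>-\<^sup>1\<close>.
  The last two conclusions, on linearity and on the occurrence of relations, make the same lemma serve
  for \<open>S\<^sub>\<Gamma>\<close> and for \<open>R\<^sub>\<Gamma>\<close>.
\<close>

lemma product_normal_forms:
  assumes p: "nz_path \<Gamma> p" and b: "lin_rels \<Gamma> b" and pb: "path_rng \<Gamma> p = rng \<Gamma> (last b)"
    and q: "nz_path \<Gamma> q" and d: "lin_rels \<Gamma> d" and qd: "path_rng \<Gamma> q = rng \<Gamma> (last d)"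
  shows "cls \<Gamma> ((p @ inv_word b) @ (q @ inv_word d)) = cls \<Gamma> [Zero] \<or>
    (\<exists>r c. nz_path \<Gamma> r \<and> lin_rels \<Gamma> c \<and> path_rng \<Gamma> r = rng \<Gamma> (last c) \<and>
      cls \<Gamma> ((p @ inv_word b) @ (q @ inv_word d)) = cls \<Gamma> (r @ inv_word c) \<and>
      (linear_path \<Gamma> p \<and> linear_path \<Gamma> q \<longrightarrow> linear_path \<Gamma> r) \<and> Rel -` set p \<subseteq> Rel -` set r)"
proof -
  let ?w = "(p @ inv_word b) @ (q @ inv_word d)"
  note ps = nz_path_symbs[OF p] and ds = inv_word_symbs[OF d]
  have pne: "p \<noteq> []" using p by (simp add: nz_path_def)
  have w: "inv_word b @ q \<in> nwords \<Gamma>"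
    using inv_word_nwords[OF b] nz_path_nwords[OF q] by (rule nwords_append)
  have rw: "cls \<Gamma> ?w = cls \<Gamma> (p @ v @ inv_word d)"
    if "cls \<Gamma> (inv_word b @ q) = cls \<Gamma> v" "v \<in> nwords \<Gamma>" for v
    using cls_context[OF that(1) w that(2) ps ds] by simp
  from cancel[OF b q] show ?thesis
  proof (elim disjE exE conjE)
    assume "cls \<Gamma> (inv_word b @ q) = cls \<Gamma> [Zero]"
    with cls_context_zero[OF this w ps ds] show ?thesis by simp
  next
    fix r
    assume r: "nz_path \<Gamma> r" "symb_src \<Gamma> (hd r) = rng \<Gamma> (last b)" "path_rng \<Gamma> r = path_rng \<Gamma> q"
      "linear_path \<Gamma> q \<longrightarrow> linear_path \<Gamma> r" "cls \<Gamma> (inv_word b @ q) = cls \<Gamma> r"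
    have rne: "r \<noteq> []" using r by (simp add: nz_path_def)
    have "rng \<Gamma> (last b) \<noteq> {}" using rng_nonempty lin_rels_last[OF b] by blast
    then have "nz_path \<Gamma> (p @ r)"
      and "linear_path \<Gamma> p \<and> linear_path \<Gamma> q \<longrightarrow> linear_path \<Gamma> (p @ r)"
      using p r pb pne rne by (auto simp: nz_path_append intro!: linear_path_append)
    moreover have "path_rng \<Gamma> (p @ r) = rng \<Gamma> (last d)"
      using r(3) qd rne by (simp add: path_rng_def)
    ultimately show ?thesis
      using d rw[OF r(5) nz_path_nwords[OF r(1)]]
      by (intro disjI2 exI[of _ "p @ r"] exI[of _ d]) auto
  next
    fix c
    assume c: "lin_rels \<Gamma> c" "rng \<Gamma> (last c) = rng \<Gamma> (last b)" "src \<Gamma> (hd c) = path_rng \<Gamma> q"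
      "cls \<Gamma> (inv_word b @ q) = cls \<Gamma> (inv_word c)"
    have "lin_rels \<Gamma> (d @ c)" using d c qd by (intro lin_rels_append) auto
    moreover have "path_rng \<Gamma> p = rng \<Gamma> (last (d @ c))"
      using pb c by (simp add: lin_rels_def)
    ultimately show ?thesis
      using p rw[OF c(4) inv_word_nwords[OF c(1)]]
      by (intro disjI2 exI[of _ p] exI[of _ "d @ c"]) auto
  qed
qed

lemma normal_form_nwords: "nz_path \<Gamma> p \<Longrightarrow> lin_rels \<Gamma> b \<Longrightarrow> p @ inv_word b \<in> nwords \<Gamma>"
  by (intro nwords_append nz_path_nwords inv_word_nwords)

lemma ex_reduced_normal_form:
  assumes "nz_path \<Gamma> p" "lin_rels \<Gamma> b"
  shows "\<exists>q. reduced_path \<Gamma> q \<and> cls \<Gamma> (q @ inv_word b) = cls \<Gamma> (p @ inv_word b) \<and>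
    path_rng \<Gamma> q = path_rng \<Gamma> p \<and> (linear_path \<Gamma> p \<longrightarrow> linear_path \<Gamma> q) \<and> Rel -` set q = Rel -` set p"
proof -
  from ex_reduced_path[OF assms(1)] obtain q where q: "reduced_path \<Gamma> q" "cls \<Gamma> q = cls \<Gamma> p"
    "path_rng \<Gamma> q = path_rng \<Gamma> p" "linear_path \<Gamma> p \<longrightarrow> linear_path \<Gamma> q"
    "Rel -` set q = Rel -` set p" by blast
  then have "nz_path \<Gamma> q" by (simp add: reduced_path_def)
  then have "cls \<Gamma> (q @ inv_word b) = cls \<Gamma> (p @ inv_word b)"
    using q(2) assms by (intro cls_append_cong nz_path_nwords inv_word_nwords) auto
  with q show ?thesis by blast
qed

lemma S_net_eq:
  "S_net \<Gamma> = {cls \<Gamma> (p @ inv_word b) |p b. nz_path \<Gamma> p \<and> lin_rels \<Gamma> b \<and>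
     path_rng \<Gamma> p = rng \<Gamma> (last b)} \<union> {cls \<Gamma> [Zero]}" (is "_ = ?N \<union> _")
proof -
  define P where "P q \<alpha> \<beta> \<longleftrightarrow> \<alpha> \<in> RP \<Gamma> - {[Zero]} \<and> \<beta> \<in> RLP \<Gamma> - T0_paths \<Gamma> \<and>
       path_rng \<Gamma> \<alpha> = path_rng \<Gamma> \<beta> \<and> q = cls \<Gamma> (\<alpha> @ path_inv \<beta>)" for q \<alpha> \<beta>
  define N where "N = ?N"
  have "q \<in> N" if "P q \<alpha> \<beta>" for q \<alpha> \<beta>
  proof -
    from that obtain b where b: "lin_rels \<Gamma> b" "\<beta> = map Rel b" unfolding P_def RLP_minus_T0 by blast
    then have "nz_path \<Gamma> \<alpha>" "path_rng \<Gamma> \<alpha> = rng \<Gamma> (last b)" "q = cls \<Gamma> (\<alpha> @ inv_word b)"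
      using that path_rng_Rel[of b \<Gamma>]
      by (auto simp: P_def RP_def reduced_path_def path_inv_Rel lin_rels_def)
    with b show ?thesis unfolding N_def by blast
  qed
  moreover have "q \<in> Q_net \<Gamma> \<and> (\<exists>\<alpha> \<beta>. P q \<alpha> \<beta>)" if "q \<in> N" for q
  proof -
    from that obtain p b where pb: "q = cls \<Gamma> (p @ inv_word b)" "nz_path \<Gamma> p" "lin_rels \<Gamma> b"
      "path_rng \<Gamma> p = rng \<Gamma> (last b)" unfolding N_def by blast
    obtain r where r: "reduced_path \<Gamma> r" "cls \<Gamma> (r @ inv_word b) = cls \<Gamma> (p @ inv_word b)"
      "path_rng \<Gamma> r = path_rng \<Gamma> p"
      using ex_reduced_normal_form[OF pb(2,3)] by blast
    have "r \<noteq> [Zero]" using r(1) by (auto simp: reduced_path_def nz_path_def pos_symbs_def)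
    moreover have "b \<noteq> []" using pb by (simp add: lin_rels_def)
    ultimately have "P q r (map Rel b)"
      using r pb unfolding P_def RLP_minus_T0 by (auto simp: RP_def path_inv_Rel path_rng_Rel)
    with pb normal_form_nwords cls_Q_net show ?thesis by blast
  qed
  ultimately have "{q \<in> Q_net \<Gamma>. \<exists>\<alpha> \<beta>. P q \<alpha> \<beta>} = N" by blast
  then show ?thesis unfolding S_net_def P_def N_def
    by (rule arg_cong[where f = "\<lambda>X. X \<union> {cls \<Gamma> [Zero]}"])
qed

lemma R_net_eq:
  "R_net \<Gamma> = {cls \<Gamma> (map Rel a @ inv_word b) |a b. lin_rels \<Gamma> a \<and> lin_rels \<Gamma> b \<and>
     rng \<Gamma> (last a) = rng \<Gamma> (last b)} \<union> {cls \<Gamma> [Zero]}" (is "_ = ?N \<union> _")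
proof -
  define P where "P q \<alpha> \<beta> \<longleftrightarrow> \<alpha> \<in> RLP \<Gamma> - T0_paths \<Gamma> \<and> \<beta> \<in> RLP \<Gamma> - T0_paths \<Gamma> \<and>
       path_rng \<Gamma> \<alpha> = path_rng \<Gamma> \<beta> \<and> q = cls \<Gamma> (\<alpha> @ path_inv \<beta>)" for q \<alpha> \<beta>
  define N where "N = ?N"
  have P_iff: "P q (map Rel a) (map Rel b) \<longleftrightarrow> lin_rels \<Gamma> a \<and> lin_rels \<Gamma> b \<and>
      rng \<Gamma> (last a) = rng \<Gamma> (last b) \<and> q = cls \<Gamma> (map Rel a @ inv_word b)" for q a b
    unfolding P_def RLP_minus_T0 using path_rng_Rel[of a \<Gamma>] path_rng_Rel[of b \<Gamma>]
    by (auto simp: path_inv_Rel lin_rels_def inj_map_eq_map inj_def)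
  have "\<exists>a b. \<alpha> = map Rel a \<and> \<beta> = map Rel b" if "P q \<alpha> \<beta>" for q \<alpha> \<beta>
    using that unfolding P_def RLP_minus_T0 by blast
  then have "(\<exists>\<alpha> \<beta>. P q \<alpha> \<beta>) \<longleftrightarrow> (\<exists>a b. P q (map Rel a) (map Rel b))" for q
    by metis
  then have "(\<exists>\<alpha> \<beta>. P q \<alpha> \<beta>) \<longleftrightarrow> q \<in> N" for q
    unfolding P_iff N_def by auto
  moreover have "N \<subseteq> S_net \<Gamma>"
  proof
    fix q assume "q \<in> N"
    then obtain a b where ab: "q = cls \<Gamma> (map Rel a @ inv_word b)" "lin_rels \<Gamma> a" "lin_rels \<Gamma> b"
      "rng \<Gamma> (last a) = rng \<Gamma> (last b)" unfolding N_def by blast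
    then have "path_rng \<Gamma> (map Rel a) = rng \<Gamma> (last b)"
      using path_rng_Rel[of a \<Gamma>] by (simp add: lin_rels_def)
    with ab Rel_path show "q \<in> S_net \<Gamma>" unfolding S_net_eq by blast
  qed
  ultimately have "{q \<in> S_net \<Gamma>. \<exists>\<alpha> \<beta>. P q \<alpha> \<beta>} = N" by blast
  then show ?thesis unfolding R_net_def P_def N_def
    by (rule arg_cong[where f = "\<lambda>X. X \<union> {cls \<Gamma> [Zero]}"])
qed

lemma R_net_cases:
  assumes "q \<in> R_net \<Gamma>"
  obtains "q = cls \<Gamma> [Zero]"
  | a b where "q = cls \<Gamma> (map Rel a @ inv_word b)" "lin_rels \<Gamma> a" "lin_rels \<Gamma> b"
      "rng \<Gamma> (last a) = rng \<Gamma> (last b)"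
  using assms unfolding R_net_eq by blast

lemma R_net_nonzero:
  assumes "q \<in> R_net \<Gamma>" "q \<noteq> cls \<Gamma> [Zero]"
  shows "\<exists>a b. q = cls \<Gamma> (map Rel a @ inv_word b) \<and> lin_rels \<Gamma> a \<and> lin_rels \<Gamma> b \<and>
    rng \<Gamma> (last a) = rng \<Gamma> (last b)"
  using assms unfolding R_net_eq by simp

lemma S_net_subset_Q: "S_net \<Gamma> \<subseteq> Q_net \<Gamma>"
  unfolding S_net_eq by (auto intro!: cls_Q_net normal_form_nwords Zero_nwords)

lemma Zero_S_net: "cls \<Gamma> [Zero] \<in> S_net \<Gamma>"
  by (simp add: S_net_def)

lemma Zero_R_net: "cls \<Gamma> [Zero] \<in> R_net \<Gamma>"
  by (simp add: R_net_def)

lemma R_net_subset_S: "R_net \<Gamma> \<subseteq> S_net \<Gamma>"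
  unfolding R_net_def by (intro Un_least Collect_restrict) (simp add: Zero_S_net)

lemma R_net_subset_Q: "R_net \<Gamma> \<subseteq> Q_net \<Gamma>"
  using R_net_subset_S S_net_subset_Q by (rule subset_trans)

lemma Qmult_Zero:
  assumes "q \<in> Q_net \<Gamma>"
  shows "Qmult \<Gamma> (cls \<Gamma> [Zero]) q = cls \<Gamma> [Zero]" "Qmult \<Gamma> q (cls \<Gamma> [Zero]) = cls \<Gamma> [Zero]"
proof -
  obtain w where w: "w \<in> nwords \<Gamma>" "q = cls \<Gamma> w" using Q_net_cls[OF assms] by blast
  then have "set w \<subseteq> symbs \<Gamma>" by (simp add: nwords_def)
  with w show "Qmult \<Gamma> (cls \<Gamma> [Zero]) q = cls \<Gamma> [Zero]" "Qmult \<Gamma> q (cls \<Gamma> [Zero]) = cls \<Gamma> [Zero]"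
    by (simp_all add: Qmult_cls Zero_nwords cls_Zero_left[of w] cls_Zero_right)
qed

lemma S_net_closed:
  assumes "x \<in> S_net \<Gamma>" "y \<in> S_net \<Gamma>"
  shows "Qmult \<Gamma> x y \<in> S_net \<Gamma>"
proof (cases "x = cls \<Gamma> [Zero] \<or> y = cls \<Gamma> [Zero]")
  case True
  then have "Qmult \<Gamma> x y = cls \<Gamma> [Zero]" using assms S_net_subset_Q Qmult_Zero by blast
  then show ?thesis by (simp only: Zero_S_net)
next
  case False
  with assms obtain p b q d where *: "x = cls \<Gamma> (p @ inv_word b)" "y = cls \<Gamma> (q @ inv_word d)"
    "nz_path \<Gamma> p" "lin_rels \<Gamma> b" "path_rng \<Gamma> p = rng \<Gamma> (last b)"
    "nz_path \<Gamma> q" "lin_rels \<Gamma> d" "path_rng \<Gamma> q = rng \<Gamma> (last d)"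
    unfolding S_net_eq by blast
  then have "Qmult \<Gamma> x y = cls \<Gamma> ((p @ inv_word b) @ (q @ inv_word d))"
    by (simp only: Qmult_cls normal_form_nwords)
  with product_normal_forms[OF *(3-8)] show ?thesis unfolding S_net_eq by auto
qed

lemma R_net_closed:
  assumes "x \<in> R_net \<Gamma>" "y \<in> R_net \<Gamma>"
  shows "Qmult \<Gamma> x y \<in> R_net \<Gamma>"
proof (cases "x = cls \<Gamma> [Zero] \<or> y = cls \<Gamma> [Zero]")
  case True
  then have "Qmult \<Gamma> x y = cls \<Gamma> [Zero]"
    by (elim disjE) (simp_all only: Qmult_Zero assms[THEN subsetD[OF R_net_subset_Q]])
  then show ?thesis by (simp only: Zero_R_net)
next
  case False
  then have "x \<noteq> cls \<Gamma> [Zero]" "y \<noteq> cls \<Gamma> [Zero]" by simp_all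
  note nonzero = R_net_nonzero[OF assms(1) this(1)] R_net_nonzero[OF assms(2) this(2)]
  obtain a b where ab: "x = cls \<Gamma> (map Rel a @ inv_word b)" "lin_rels \<Gamma> a" "lin_rels \<Gamma> b"
    "rng \<Gamma> (last a) = rng \<Gamma> (last b)"
    using nonzero(1) by (elim exE conjE)
  obtain c d where cd: "y = cls \<Gamma> (map Rel c @ inv_word d)" "lin_rels \<Gamma> c" "lin_rels \<Gamma> d"
    "rng \<Gamma> (last c) = rng \<Gamma> (last d)"
    using nonzero(2) by (elim exE conjE)
  note * = ab(1) cd(1) ab(2-4) cd(2-4)
  note pa = Rel_path[OF *(3)] and pc = Rel_path[OF *(6)]
  have ne: "a \<noteq> []" "c \<noteq> []" using * by (auto simp: lin_rels_def)
  let ?w = "(map Rel a @ inv_word b) @ (map Rel c @ inv_word d)"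
  have w: "Qmult \<Gamma> x y = cls \<Gamma> ?w"
    using * pa pc by (simp only: Qmult_cls normal_form_nwords)
  consider "cls \<Gamma> ?w = cls \<Gamma> [Zero]"
    | r e where "nz_path \<Gamma> r" "lin_rels \<Gamma> e" "path_rng \<Gamma> r = rng \<Gamma> (last e)"
      "cls \<Gamma> ?w = cls \<Gamma> (r @ inv_word e)" "linear_path \<Gamma> r"
      "Rel -` set (map Rel a :: ('v, 't) symb list) \<subseteq> Rel -` set r"
  proof -
    have "path_rng \<Gamma> (map Rel a) = rng \<Gamma> (last b)" "path_rng \<Gamma> (map Rel c) = rng \<Gamma> (last d)"
      using * ne by (simp_all add: path_rng_Rel)
    with product_normal_forms[of "map Rel a" b "map Rel c" d] pa pc * that show ?thesis by blast
  qed
  then show ?thesis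
  proof cases
    case 1
    with w show ?thesis by (simp only: Zero_R_net)
  next
    case 2
    obtain q where q: "reduced_path \<Gamma> q" "cls \<Gamma> (q @ inv_word e) = cls \<Gamma> (r @ inv_word e)"
      "path_rng \<Gamma> q = path_rng \<Gamma> r" "linear_path \<Gamma> r \<longrightarrow> linear_path \<Gamma> q"
      "Rel -` set q = Rel -` set r"
      using ex_reduced_normal_form[OF 2(1,2)] by blast
    \<comment> \<open>A relation of \<open>a\<close> survives in \<open>q\<close>, so \<open>q\<close> has not been reduced to a vertex set.\<close>
    have "hd a \<in> Rel -` set (map Rel a :: ('v, 't) symb list)" using ne by simp
    then have "hd a \<in> Rel -` set q" using 2(6) q(5) by blast
    then have "q \<notin> T0_paths \<Gamma>" by (auto simp: T0_paths_def)
    with q 2 have "q \<in> RLP \<Gamma> - T0_paths \<Gamma>" by (simp add: RLP_def)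
    then obtain f where f: "lin_rels \<Gamma> f" "q = map Rel f" unfolding RLP_minus_T0 by blast
    then have "rng \<Gamma> (last f) = rng \<Gamma> (last e)"
      using q 2 path_rng_Rel[of f \<Gamma>] by (simp add: lin_rels_def)
    with f q 2 w show ?thesis unfolding R_net_eq by auto
  qed
qed

end

section \<open>The representation by prefixing paths\<close>

fun step :: "('v, 't) pre_network \<Rightarrow> ('v, 't) symb \<Rightarrow> ('v set \<times> 't list) rel" where
  "step \<Gamma> (Rel t) = {((rng \<Gamma> t, p), (src \<Gamma> t, t # p)) |p. True}"
| "step \<Gamma> (Obj A) = {((A, p), (A, p)) |p. True}"
| "step \<Gamma> (Inv t) = {((src \<Gamma> t, t # p), (rng \<Gamma> t, p)) |p. True}"
| "step \<Gamma> Zero = {}"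

text \<open>The last symbol of a word acts first, as in a product of functions written on the left.\<close>

primrec act :: "('v, 't) pre_network \<Rightarrow> ('v, 't) symb list \<Rightarrow> ('v set \<times> 't list) rel" where
  "act \<Gamma> [] = Id"
| "act \<Gamma> (x # w) = act \<Gamma> w O step \<Gamma> x"

lemma act_append: "act \<Gamma> (u @ v) = act \<Gamma> v O act \<Gamma> u"
  by (induction u) auto

text \<open>All words in a class act alike, so the union below is just their common value.\<close>

definition class_act :: "('v, 't) pre_network \<Rightarrow> ('v, 't) symb list set \<Rightarrow> ('v set \<times> 't list) rel" where
  "class_act \<Gamma> q = (\<Union>w\<in>q. act \<Gamma> w)"

context network
begin

text \<open>
  A product of symbols with disjoint range and source acts as the empty relation because two
  disjoint sets in \<open>T\<^sup>0\<close>, being non-empty, are different.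
\<close>

lemma act_nrels:
  assumes "(u, v) \<in> nrels \<Gamma>"
  shows "act \<Gamma> u = act \<Gamma> v"
  using assms
proof cases
  case (NR2 x y)
  have "symb_rng \<Gamma> x \<noteq> {}" "symb_src \<Gamma> y \<noteq> {}"
    using NR2 symb_rng_T0 symb_src_T0 T0_nonempty by blast+
  with NR2 show ?thesis by (cases x; cases y) auto
next
  case (NR1_src x)
  then show ?thesis by (cases x) auto
next
  case (NR1_rng x)
  then show ?thesis by (cases x) auto
qed auto

lemma act_Qcong:
  assumes "(u, v) \<in> Qcong \<Gamma>"
  shows "act \<Gamma> u = act \<Gamma> v"
proof -
  let ?\<rho> = "{(u, v). u \<in> nwords \<Gamma> \<and> v \<in> nwords \<Gamma> \<and> act \<Gamma> u = act \<Gamma> v}"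
  have "equiv (nwords \<Gamma>) ?\<rho>"
    by (auto intro!: equivI refl_onI symI transI)
  then have "semigroup_congruence (nwords \<Gamma>) (@) ?\<rho>"
    by (simp add: semigroup_congruence_def act_append nwords_append)
  moreover have "nrels \<Gamma> \<subseteq> ?\<rho>" using act_nrels nrels_nwords by blast
  ultimately show ?thesis using assms unfolding Qcong_def by blast
qed

lemma class_act_cls: "w \<in> nwords \<Gamma> \<Longrightarrow> class_act \<Gamma> (cls \<Gamma> w) = act \<Gamma> w"
  using act_Qcong equiv_class_self[OF equiv_Qcong] by (fastforce simp: class_act_def cls_def)

lemma class_act_Qmult:
  assumes "x \<in> Q_net \<Gamma>" "y \<in> Q_net \<Gamma>"
  shows "class_act \<Gamma> (Qmult \<Gamma> x y) = class_act \<Gamma> y O class_act \<Gamma> x"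
proof -
  obtain u v where "u \<in> nwords \<Gamma>" "x = cls \<Gamma> u" "v \<in> nwords \<Gamma>" "y = cls \<Gamma> v"
    using assms Q_net_cls by metis
  then show ?thesis by (simp add: Qmult_cls class_act_cls nwords_append act_append)
qed

lemma act_Rel:
  "lin_rels \<Gamma> a \<Longrightarrow> act \<Gamma> (map Rel a) = {((rng \<Gamma> (last a), p), (src \<Gamma> (hd a), a @ p)) |p. True}"
proof (induction a)
  case (Cons t a)
  then show ?case by (cases "a = []") (auto simp: lin_rels_Cons)
qed (simp add: lin_rels_def)

lemma act_inv_word:
  "lin_rels \<Gamma> b \<Longrightarrow> act \<Gamma> (inv_word b) = {((src \<Gamma> (hd b), b @ p), (rng \<Gamma> (last b), p)) |p. True}"
proof (induction b)
  case (Cons t b)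
  then show ?case by (cases "b = []") (auto simp: lin_rels_Cons act_append)
qed (simp add: lin_rels_def)

lemma class_act_normal_form:
  assumes "lin_rels \<Gamma> a" "lin_rels \<Gamma> b" "rng \<Gamma> (last a) = rng \<Gamma> (last b)"
  shows "class_act \<Gamma> (cls \<Gamma> (map Rel a @ inv_word b)) =
    {((src \<Gamma> (hd b), b @ p), (src \<Gamma> (hd a), a @ p)) |p. True}"
  using assms Rel_path[OF assms(1)]
  by (auto simp: class_act_cls normal_form_nwords act_append act_Rel act_inv_word)

lemma class_act_Zero: "class_act \<Gamma> (cls \<Gamma> [Zero]) = {}"
  by (simp add: class_act_cls Zero_nwords)

section \<open>Inverses and Green's relation on \<open>R\<^sub>\<Gamma>\<close>\<close>

text \<open>The set of all extensions of \<open>b\<close> determines \<open>b\<close>, as its only shortest element.\<close>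

lemma prefix_cone_inj:
  assumes "{(A, b @ p) |p. True} = {(B, d @ p) |p. True}"
  shows "b = d"
proof -
  have "(A, b @ []) \<in> {(B, d @ p) |p. True}" "(B, d @ []) \<in> {(A, b @ p) |p. True}"
    using assms by blast+
  then show ?thesis by auto
qed

lemma Domain_Range_determine:
  assumes "x \<in> R_net \<Gamma>" "y \<in> R_net \<Gamma>"
    and "Domain (class_act \<Gamma> x) = Domain (class_act \<Gamma> y)"
    and "Range (class_act \<Gamma> x) = Range (class_act \<Gamma> y)"
  shows "x = y"
proof -
  have D: "Domain {((A, b @ p), (B, a @ p)) |p. True} = {(A, b @ p) |p. True}"
    and R: "Range {((A, b @ p), (B, a @ p)) |p. True} = {(B, a @ p) |p. True}"
    for A B :: "'v set" and a b :: "'t list" by auto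
  show ?thesis
    using assms(1)
  proof (cases rule: R_net_cases)
    case 1
    have "class_act \<Gamma> y = {}" using assms(3) unfolding 1 class_act_Zero by auto
    with assms(2) 1 show ?thesis
      by (cases rule: R_net_cases) (auto simp: class_act_normal_form)
  next
    case x: (2 a b)
    show ?thesis
      using assms(2)
    proof (cases rule: R_net_cases)
      case 1
      with x assms(3) show ?thesis by (auto simp: class_act_normal_form class_act_Zero)
    next
      case y: (2 c d)
      have "b = d" "a = c"
        using assms(3,4) x y by (auto simp only: class_act_normal_form D R dest: prefix_cone_inj)
      with x y show ?thesis by simp
    qed
  qed
qed

lemma class_act_partial_injection:
  assumes "x \<in> R_net \<Gamma>"
  shows "single_valued (class_act \<Gamma> x)" "single_valued ((class_act \<Gamma> x)\<inverse>)"
  using assms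
  by (cases rule: R_net_cases;
      auto simp: class_act_normal_form class_act_Zero single_valued_def)+

end

lemma converse_subset_weak_inverse:
  assumes "f O g O f = f" "single_valued f" "single_valued (f\<inverse>)"
  shows "f\<inverse> \<subseteq> g"
proof (rule subrelI)
  fix y x assume yx: "(y, x) \<in> f\<inverse>"
  then have "(x, y) \<in> f O g O f" using assms(1) by simp
  then obtain u v where "(x, u) \<in> f" "(u, v) \<in> g" "(v, y) \<in> f" by blast
  moreover from this have "u = y" "v = x"
    using yx assms(2,3) by (auto dest: single_valuedD)
  ultimately show "(y, x) \<in> g" by simp
qed

lemma partial_injection_inverse_unique:
  assumes "single_valued f" "single_valued (f\<inverse>)" "single_valued g" "single_valued (g\<inverse>)"
    and "f O g O f = f" "g O f O g = g"
  shows "g = f\<inverse>"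
proof -
  have "f\<inverse> \<subseteq> g" "g\<inverse> \<subseteq> f"
    using assms converse_subset_weak_inverse by blast+
  then show ?thesis by auto
qed

context network
begin

lemma semigroup_R_net: "semigroup_on (R_net \<Gamma>) (Qmult \<Gamma>)"
proof (rule semigroup_on_Q_subset[OF R_net_subset_Q _ R_net_closed])
  show "R_net \<Gamma> \<noteq> {}" using Zero_R_net by blast
qed

lemma semigroup_S_net: "semigroup_on (S_net \<Gamma>) (Qmult \<Gamma>)"
proof (rule semigroup_on_Q_subset[OF S_net_subset_Q _ S_net_closed])
  show "S_net \<Gamma> \<noteq> {}" using Zero_S_net by blast
qed

lemma R_net_ex_converse:
  assumes "x \<in> R_net \<Gamma>"
  shows "\<exists>y \<in> R_net \<Gamma>. class_act \<Gamma> y = (class_act \<Gamma> x)\<inverse>"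
  using assms
proof (cases rule: R_net_cases)
  case 1
  then show ?thesis using assms class_act_Zero by auto
next
  case (2 a b)
  let ?y = "cls \<Gamma> (map Rel b @ inv_word a)"
  have "?y \<in> R_net \<Gamma>" unfolding R_net_eq using 2(2,3) 2(4)[symmetric] by blast
  moreover have "class_act \<Gamma> ?y = (class_act \<Gamma> x)\<inverse>"
    using 2 by (auto simp: class_act_normal_form)
  ultimately show ?thesis by blast
qed

lemma inverse_semigroup_R_net: "inverse_semigroup (R_net \<Gamma>) (Qmult \<Gamma>)"
  unfolding inverse_semigroup_def
proof (intro conjI semigroup_R_net ballI)
  fix x assume x: "x \<in> R_net \<Gamma>"
  let ?m = "Qmult \<Gamma>" and ?\<phi> = "class_act \<Gamma>"
  have mult: "?\<phi> (?m (?m u v) u) = ?\<phi> u O ?\<phi> v O ?\<phi> u" if "u \<in> R_net \<Gamma>" "v \<in> R_net \<Gamma>" for u v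
    using that R_net_subset_Q by (simp add: class_act_Qmult Qmult_closed subset_iff)
  have inj: "u = v" if "u \<in> R_net \<Gamma>" "v \<in> R_net \<Gamma>" "?\<phi> u = ?\<phi> v" for u v
    using that Domain_Range_determine by simp
  obtain y where y: "y \<in> R_net \<Gamma>" "?\<phi> y = (?\<phi> x)\<inverse>" using R_net_ex_converse[OF x] by blast
  have "f O f\<inverse> O f = f" if "single_valued f" for f :: "('v set \<times> 't list) rel"
    using that by (auto dest: single_valuedD)
  from this[OF class_act_partial_injection(1)[OF x]] this[OF class_act_partial_injection(2)[OF x]]
  have "?\<phi> (?m (?m x y) x) = ?\<phi> x" "?\<phi> (?m (?m y x) y) = ?\<phi> y"
    using x y mult by simp_all
  then have "?m (?m x y) x = x" "?m (?m y x) y = y"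
    using x y(1) by (simp_all add: inj R_net_closed)
  moreover have "z = y" if z: "z \<in> R_net \<Gamma>" "?m (?m x z) x = x" "?m (?m z x) z = z" for z
  proof -
    have "?\<phi> z = (?\<phi> x)\<inverse>"
      using partial_injection_inverse_unique[of "?\<phi> x" "?\<phi> z"] class_act_partial_injection x z
        mult[OF x z(1)] mult[OF z(1) x] by simp
    with y z inj show ?thesis by simp
  qed
  ultimately show "\<exists>!y. y \<in> R_net \<Gamma> \<and> ?m (?m x y) x = x \<and> ?m (?m y x) y = y"
    using y(1) by blast
qed

text \<open>
  In \<open>u v\<close> the factor \<open>v\<close> acts first, so left multiples of \<open>v\<close> cannot have a larger domain and right
  multiples of \<open>u\<close> cannot have a larger range; elements generating the same one-sided ideals have
  equal domains and ranges.
\<close>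

lemma green_H_R_net_trivial:
  assumes "(x, y) \<in> green_H (R_net \<Gamma>) (Qmult \<Gamma>)"
  shows "x = y"
proof -
  let ?\<phi> = "class_act \<Gamma>"
  have xy: "x \<in> R_net \<Gamma>" "y \<in> R_net \<Gamma>"
    and L: "left_ideal (R_net \<Gamma>) (Qmult \<Gamma>) x = left_ideal (R_net \<Gamma>) (Qmult \<Gamma>) y"
    and R: "right_ideal (R_net \<Gamma>) (Qmult \<Gamma>) x = right_ideal (R_net \<Gamma>) (Qmult \<Gamma>) y"
    using assms by (auto simp: green_H_def green_L_def green_R_def)
  have dom: "Domain (?\<phi> u) \<subseteq> Domain (?\<phi> v)"
    if "u \<in> left_ideal (R_net \<Gamma>) (Qmult \<Gamma>) v" "v \<in> R_net \<Gamma>" for u v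
    using that R_net_subset_Q by (auto simp: left_ideal_def class_act_Qmult subset_iff)
  have ran: "Range (?\<phi> u) \<subseteq> Range (?\<phi> v)"
    if "u \<in> right_ideal (R_net \<Gamma>) (Qmult \<Gamma>) v" "v \<in> R_net \<Gamma>" for u v
    using that R_net_subset_Q by (auto simp: right_ideal_def class_act_Qmult subset_iff)
  have "x \<in> left_ideal (R_net \<Gamma>) (Qmult \<Gamma>) y" "y \<in> left_ideal (R_net \<Gamma>) (Qmult \<Gamma>) x"
    "x \<in> right_ideal (R_net \<Gamma>) (Qmult \<Gamma>) y" "y \<in> right_ideal (R_net \<Gamma>) (Qmult \<Gamma>) x"
    using L R by (auto simp: left_ideal_def right_ideal_def)
  then have "Domain (?\<phi> x) = Domain (?\<phi> y)" "Range (?\<phi> x) = Range (?\<phi> y)"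
    using dom ran xy by (simp_all add: subset_antisym)
  with xy show ?thesis by (rule Domain_Range_determine)
qed

lemma fundamental_R_net: "fundamental_semigroup (R_net \<Gamma>) (Qmult \<Gamma>)"
  unfolding fundamental_semigroup_def
proof (intro conjI semigroup_R_net allI impI, elim conjE)
  fix \<rho>
  assume \<rho>: "semigroup_congruence (R_net \<Gamma>) (Qmult \<Gamma>) \<rho>" "\<rho> \<subseteq> green_H (R_net \<Gamma>) (Qmult \<Gamma>)"
  have "\<rho> \<subseteq> R_net \<Gamma> \<times> R_net \<Gamma>" "refl_on (R_net \<Gamma>) \<rho>"
    using \<rho>(1) by (auto simp: semigroup_congruence_def elim!: equivE)
  moreover have "x = y" if "(x, y) \<in> \<rho>" for x y
    using that \<rho>(2) green_H_R_net_trivial by blast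
  ultimately show "\<rho> = Id_on (R_net \<Gamma>)" by (auto dest: refl_onD)
qed

end

theorem corollary3p16:
  fixes \<Gamma> :: "('v, 't) pre_network"
  assumes "network \<Gamma>"
  shows "subsemigroup (R_net \<Gamma>) (S_net \<Gamma>) (Qmult \<Gamma>) \<and>
         inverse_semigroup (R_net \<Gamma>) (Qmult \<Gamma>) \<and>
         fundamental_semigroup (R_net \<Gamma>) (Qmult \<Gamma>)"
proof -
  interpret network \<Gamma> by (rule assms)
  show ?thesis
    using semigroup_S_net R_net_subset_S semigroup_R_net inverse_semigroup_R_net fundamental_R_net
    by (simp add: subsemigroup_def)
qed

end
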